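(* Let $N_A$ be a seminorm on $\mathbb{B}_A(\mathcal{H})$ satisfying the $A$-power property and let $T\in\mathbb{B}_A(\mathcal{H})$. Then $$\omega_{N_A}(T)\le\sqrt{\frac12\,\omega_{N_A}(T^2)+\frac14 N_A\big(T^{\sharp_A}T+TT^{\sharp_A}\big)}.$$
   Context: $\mathcal{H}$ is a complex Hilbert space with inner product $\langle\cdot,\cdot\rangle$, $\mathbb{B}(\mathcal{H})$ is the algebra of bounded linear operators on $\mathcal{H}$, and $A\in\mathbb{B}(\mathcal{H})$ is a non-zero positive operator ($\langle Ax,x\rangle\ge 0$ for all $x$). $\mathbb{B}_A(\mathcal{H})$ is the set of $T\in\mathbb{B}(\mathcal{H})$ with $\mathcal{R}(T^*A)\subseteq\mathcal{R}(A)$ ($\mathcal{R}$ denotes range); it is a subalgebra of $\mathbb{B}(\mathcal{H})$. For $T\in\mathbb{B}_A(\mathcal{H})$, $T^{\sharp_A}$ is the unique $X\in\mathbb{B}(\mathcal{H})$ with $AX=T^*A$ and $\mathcal{R}(X)\subseteq\overline{\mathcal{R}(A)}$; one has $T^{\sharp_A}\in\mathbb{B}_A(\mathcal{H})$. Put $\Re_A(T)=\frac{T+T^{\sharp_A}}{2}$. $T\in\mathbb{B}_A(\mathcal{H})$ is $A$-selfadjoint if $AT=T^*A$. For a seminorm $N_A$ on $\mathbb{B}_A(\mathcal{H})$, the generalized $A$-numerical radius is $\omega_{N_A}(T)=\sup_{\theta\in\mathbb{R}}N_A\big(\Re_A(e^{i\theta}T)\big)$ for $T\in\mathbb{B}_A(\mathcal{H})$.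 $N_A$ satisfies the $A$-power property if $N_A(T^n)=(N_A(T))^n$ for every $A$-selfadjoint operator $T\in\mathbb{B}_A(\mathcal{H})$ and every positive integer $n$. *)

theory Defs
  imports "HOL-Analysis.Analysis"
begin

text \<open>
  Complex Hilbert spaces. The complex inner product is linear in its first argument. A complex
  Hilbert space is viewed as a complete real inner product space (the library class) whose real
  inner product is the real part of the complex one; hence, by conjugate symmetry,
  \<open>cinner x x = (norm x)\<^sup>2\<close>, and the library norm and topology are those induced by \<open>cinner\<close>.
\<close>

class complex_hilbert_space = real_inner + complete_space +
  fixes scaleC :: "complex \<Rightarrow> 'a \<Rightarrow> 'a"  (infixr \<open>*\<^sub>C\<close> 75)
    and cinner :: "'a \<Rightarrow> 'a \<Rightarrow> complex"
  assumes scaleC_add_right: "c *\<^sub>C (x + y) = c *\<^sub>C x + c *\<^sub>C y"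
    and scaleC_add_left: "(c + d) *\<^sub>C x = c *\<^sub>C x + d *\<^sub>C x"
    and scaleC_scaleC: "c *\<^sub>C d *\<^sub>C x = (c * d) *\<^sub>C x"
    and scaleC_of_real: "complex_of_real r *\<^sub>C x = r *\<^sub>R x"
    and cinner_commute: "cinner x y = cnj (cinner y x)"
    and cinner_add_left: "cinner (x + y) z = cinner x z + cinner y z"
    and cinner_scaleC_left: "cinner (c *\<^sub>C x) y = c * cinner x y"
    and inner_eq_Re_cinner: "inner x y = Re (cinner x y)"

instantiation complex :: complex_hilbert_space
begin

definition scaleC_complex :: "complex \<Rightarrow> complex \<Rightarrow> complex"
  where "scaleC_complex c x = c * x"

definition cinner_complex :: "complex \<Rightarrow> complex \<Rightarrow> complex"
  where "cinner_complex x y = x * cnj y"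

instance
  by standard
    (auto simp: scaleC_complex_def cinner_complex_def inner_complex_def algebra_simps
      scaleR_conv_of_real)

end

text \<open>
  Operators are plain functions; the elements of \<open>\<bool>(\<H>)\<close> are the functions satisfying
  \<open>bounded_clinear\<close>. Products of operators are compositions, powers are \<open>^^\<close>, and sums and scalar
  multiples are taken pointwise.
\<close>

definition bounded_clinear ::
    "('a::complex_hilbert_space \<Rightarrow> 'b::complex_hilbert_space) \<Rightarrow> bool"
  where "bounded_clinear T \<longleftrightarrow> bounded_linear T \<and> (\<forall>c x. T (c *\<^sub>C x) = c *\<^sub>C T x)"

definition cadjoint ::
    "('a::complex_hilbert_space \<Rightarrow> 'b::complex_hilbert_space) \<Rightarrow> 'b \<Rightarrow> 'a"
  where "cadjoint T =
    (THE S. bounded_clinear S \<and> (\<forall>x y. cinner (T x) y = cinner x (S y)))"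

definition positive_op :: "('a::complex_hilbert_space \<Rightarrow> 'a) \<Rightarrow> bool"
  where "positive_op A \<longleftrightarrow> bounded_clinear A \<and>
    (\<forall>x. cinner (A x) x \<in> \<real> \<and> 0 \<le> Re (cinner (A x) x))"

definition A_bounded_ops :: "('a::complex_hilbert_space \<Rightarrow> 'a) \<Rightarrow> ('a \<Rightarrow> 'a) set"
  where "A_bounded_ops A = {T. bounded_clinear T \<and> range (cadjoint T \<circ> A) \<subseteq> range A}"

definition A_adjoint :: "('a::complex_hilbert_space \<Rightarrow> 'a) \<Rightarrow> ('a \<Rightarrow> 'a) \<Rightarrow> 'a \<Rightarrow> 'a"
  where "A_adjoint A T =
    (THE X. bounded_clinear X \<and> A \<circ> X = cadjoint T \<circ> A \<and> range X \<subseteq> closure (range A))"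

definition A_real_part :: "('a::complex_hilbert_space \<Rightarrow> 'a) \<Rightarrow> ('a \<Rightarrow> 'a) \<Rightarrow> 'a \<Rightarrow> 'a"
  where "A_real_part A T = (\<lambda>x. (1 / 2) *\<^sub>C (T x + A_adjoint A T x))"

definition A_selfadjoint :: "('a::complex_hilbert_space \<Rightarrow> 'a) \<Rightarrow> ('a \<Rightarrow> 'a) \<Rightarrow> bool"
  where "A_selfadjoint A T \<longleftrightarrow> A \<circ> T = cadjoint T \<circ> A"

text \<open>
  A seminorm on \<open>\<bool>\<^sub>A(\<H>)\<close> is a function on all maps of which only the values on
  \<open>A_bounded_ops A\<close> matter.
\<close>

definition A_seminorm ::
    "('a::complex_hilbert_space \<Rightarrow> 'a) \<Rightarrow> (('a \<Rightarrow> 'a) \<Rightarrow> real) \<Rightarrow> bool"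
  where "A_seminorm A N \<longleftrightarrow>
    (\<forall>T\<in>A_bounded_ops A. 0 \<le> N T) \<and>
    (\<forall>T\<in>A_bounded_ops A. \<forall>c. N (\<lambda>x. c *\<^sub>C T x) = cmod c * N T) \<and>
    (\<forall>S\<in>A_bounded_ops A. \<forall>T\<in>A_bounded_ops A. N (\<lambda>x. S x + T x) \<le> N S + N T)"

definition A_power_property ::
    "('a::complex_hilbert_space \<Rightarrow> 'a) \<Rightarrow> (('a \<Rightarrow> 'a) \<Rightarrow> real) \<Rightarrow> bool"
  where "A_power_property A N \<longleftrightarrow>
    (\<forall>T\<in>A_bounded_ops A. A_selfadjoint A T \<longrightarrow> (\<forall>n\<ge>1. N (T ^^ n) = N T ^ n))"

text \<open>
  For \<open>T \<in> \<bool>\<^sub>A(\<H>)\<close> and a seminorm \<open>N\<close> the supremum is over a bounded set: every value is at most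
  \<open>(N T + N (A_adjoint A T)) / 2\<close>.
\<close>

definition A_numerical_radius ::
    "('a::complex_hilbert_space \<Rightarrow> 'a) \<Rightarrow> (('a \<Rightarrow> 'a) \<Rightarrow> real) \<Rightarrow> ('a \<Rightarrow> 'a) \<Rightarrow> real"
  where "A_numerical_radius A N T = (SUP \<theta>::real. N (A_real_part A (\<lambda>x. cis \<theta> *\<^sub>C T x)))"

end

theory Submission
  imports Defs
begin

text \<open>
  Write \<open>R\<close> for the \<open>A\<close>-real part of \<open>e T\<close>, where \<open>e\<close> is a unit complex number, and \<open>T\<^sup>#\<close> for the
  \<open>A\<close>-adjoint of \<open>T\<close>. Expanding the square gives
  \<open>R\<^sup>2 = 1/2 \<Re>\<^sub>A(e\<^sup>2 T\<^sup>2) + 1/4 (T\<^sup># T + T T\<^sup>#)\<close> (lemma \<open>A_real_part_rotated_squared\<close>). Since \<open>R\<close> is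
  \<open>A\<close>-selfadjoint, the power property turns \<open>(N R)\<^sup>2\<close> into \<open>N (R\<^sup>2)\<close>, the triangle inequality separates
  the two summands, and the first one is at most half the numerical radius of \<open>T\<^sup>2\<close>. Taking square
  roots and then the supremum over \<open>e\<close> proves the inequality.

  This computation presupposes that \<open>A_adjoint\<close>, a definite description, denotes a bounded operator
  with the expected algebraic rules, and most of the work goes into that. Adjoints in the usual
  sense come from the Riesz representation theorem, which is obtained by minimising a quadratic
  functional over a closed subspace; the same lemma yields orthogonal projections. The map \<open>A\<close> is
  injective on the closure of its range and already takes all its values there, so the equation
  \<open>A X = T\<^sup>* A\<close> has exactly one solution with values in that closure. Its continuity, an
  instance of Douglas' range inclusion theorem, follows from the Baire category theorem (lemma
  \<open>A_adjoint_exists\<close>). The algebraic rules then follow by uniqueness, since \<open>T\<^sup>#\<close> is an adjoint of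
  \<open>T\<close> for the semi-inner product \<open>cinner (A x) y\<close>.
\<close>

section \<open>Projections and functionals in a real Hilbert space\<close>

subclass (in complex_hilbert_space) banach ..

lemma subspace_closure:
  fixes S :: "'a::real_normed_vector set"
  assumes "subspace S"
  shows "subspace (closure S)"
proof (rule subspaceI)
  show "0 \<in> closure S"
    using assms closure_subset subspace_0 by blast
next
  fix x y assume "x \<in> closure S" "y \<in> closure S"
  then obtain f g where "\<And>n. f n \<in> S" "f \<longlonglongrightarrow> x" "\<And>n. g n \<in> S" "g \<longlonglongrightarrow> y"
    unfolding closure_sequential by metis
  then have "\<And>n. f n + g n \<in> S" "(\<lambda>n. f n + g n) \<longlonglongrightarrow> x + y"
    using assms by (auto intro: subspace_add tendsto_add)
  then show "x + y \<in> closure S"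
    unfolding closure_sequential by (intro exI[of _ "\<lambda>n. f n + g n"]) auto
next
  fix c :: real and x assume "x \<in> closure S"
  then obtain f where "\<And>n. f n \<in> S" "f \<longlonglongrightarrow> x"
    unfolding closure_sequential by metis
  then have "\<And>n. c *\<^sub>R f n \<in> S" "(\<lambda>n. c *\<^sub>R f n) \<longlonglongrightarrow> c *\<^sub>R x"
    using assms by (auto intro: subspace_scale tendsto_intros)
  then show "c *\<^sub>R x \<in> closure S"
    unfolding closure_sequential by (intro exI[of _ "\<lambda>n. c *\<^sub>R f n"]) auto
qed

text \<open>
  The representing vector minimises \<open>J x = (norm x)\<^sup>2 - 2 * f x\<close> over the subspace. The parallelogram
  law makes every minimising sequence Cauchy, so completeness yields a minimiser, and the vanishing
  first variation of \<open>J\<close> there is the claimed identity. The whole space gives the Riesz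
  representation theorem; a functional \<open>\<lambda>s. inner s x\<close> gives the orthogonal projection of \<open>x\<close>.
\<close>

lemma riesz_representation_on_closed_subspace:
  fixes f :: "'a::{real_inner, complete_space} \<Rightarrow> real"
  assumes f: "bounded_linear f" and sub: "subspace S" and "closed S"
  shows "\<exists>u\<in>S. \<forall>s\<in>S. f s = inner s u"
proof -
  interpret f: bounded_linear f by fact
  obtain K where K: "\<And>x. \<bar>f x\<bar> \<le> norm x * K"
    using f.bounded by (auto simp: real_norm_def)
  define J where "J x = (norm x)\<^sup>2 - 2 * f x" for x
  have J_lower: "- K\<^sup>2 \<le> J x" for x
  proof -
    have "0 \<le> (norm x - K)\<^sup>2" by simp
    moreover have "f x \<le> norm x * K" using K[of x] by linarith
    ultimately show ?thesis by (simp add: J_def power2_diff)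
  qed
  define m where "m = Inf (J ` S)"
  have bdd: "bdd_below (J ` S)" using J_lower by (auto intro!: bdd_belowI)
  have nonempty: "J ` S \<noteq> {}" using subspace_0[OF sub] by auto
  have m_le: "m \<le> J x" if "x \<in> S" for x
    unfolding m_def using bdd that by (auto intro: cInf_lower)
  have "\<exists>x\<in>S. J x < m + 1 / real (Suc n)" for n
    using cInf_lessD[OF nonempty, of "m + 1 / real (Suc n)"] by (auto simp: m_def)
  then obtain s where s: "\<And>n. s n \<in> S" "\<And>n. J (s n) < m + 1 / real (Suc n)"
    by metis
  have par: "(norm (a - b))\<^sup>2 \<le> 2 * (J a - m) + 2 * (J b - m)" if "a \<in> S" "b \<in> S" for a b
  proof -
    define c where "c = (1/2) *\<^sub>R (a + b)"
    have "c \<in> S"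
      using that sub by (simp add: c_def subspace_add subspace_scale)
    then have "m \<le> J c" by (rule m_le)
    moreover have "(norm (a - b))\<^sup>2 = 2 * J a + 2 * J b - 4 * J c"
      by (simp add: c_def J_def power2_norm_eq_inner f.add f.scaleR inner_add inner_diff
          inner_commute field_simps)
    ultimately show ?thesis by (simp add: algebra_simps)
  qed
  have "Cauchy s"
  proof (rule metric_CauchyI)
    fix e :: real assume "0 < e"
    then obtain M where M: "1 / real (Suc M) < e\<^sup>2 / 4"
      using nat_approx_posE[of "e\<^sup>2 / 4"] by auto
    have "dist (s p) (s q) < e" if "M \<le> p" "M \<le> q" for p q
    proof -
      have "1 / real (Suc p) \<le> 1 / real (Suc M)" "1 / real (Suc q) \<le> 1 / real (Suc M)"
        using that by (auto simp: frac_le)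
      then have "(norm (s p - s q))\<^sup>2 < e\<^sup>2"
        using par[OF s(1)[of p] s(1)[of q]] s(2)[of p] s(2)[of q] M by argo
      then show ?thesis
        using \<open>0 < e\<close> by (simp add: dist_norm power_less_imp_less_base)
    qed
    then show "\<exists>M. \<forall>p\<ge>M. \<forall>q\<ge>M. dist (s p) (s q) < e" by blast
  qed
  then obtain u where u: "s \<longlonglongrightarrow> u"
    using Cauchy_convergent convergent_def by blast
  have "u \<in> S"
    using \<open>closed S\<close> s(1) u closed_sequentially by blast
  have "(\<lambda>n. J (s n)) \<longlonglongrightarrow> J u"
    unfolding J_def by (intro tendsto_intros u f.tendsto)
  moreover have "(\<lambda>n. m + 1 / real (Suc n)) \<longlonglongrightarrow> m + 0"
    using LIMSEQ_inverse_real_of_nat 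
    by (intro tendsto_intros) (simp add: inverse_eq_divide)
  ultimately have "J u \<le> m + 0"
    by (rule LIMSEQ_le) (use s(2) less_imp_le in blast)
  then have J_min: "J u \<le> m" by simp
  have "f v = inner v u" if "v \<in> S" for v
  proof (rule ccontr)
    define d where "d = f v - inner v u"
    assume "f v \<noteq> inner v u"
    then have "d \<noteq> 0" by (simp add: d_def)
    then have "v \<noteq> 0" by (auto simp: d_def f.zero)
    \<comment> \<open>The step length that minimises \<open>J\<close> along the line through \<open>u\<close> in direction \<open>v\<close>.\<close>
    define t where "t = d / (norm v)\<^sup>2"
    have "u + t *\<^sub>R v \<in> S"
      using \<open>u \<in> S\<close> that sub by (simp add: subspace_add subspace_scale)
    then have "J u \<le> J (u + t *\<^sub>R v)"
      using J_min m_le by force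
    also have "J (u + t *\<^sub>R v) = J u - 2 * t * d + t\<^sup>2 * (norm v)\<^sup>2"
      unfolding J_def d_def power2_norm_eq_inner
      by (simp add: f.add f.scaleR inner_add inner_commute power2_eq_square algebra_simps)
    also have "\<dots> = J u - d\<^sup>2 / (norm v)\<^sup>2"
      using \<open>v \<noteq> 0\<close> by (simp add: t_def power2_eq_square field_simps)
    finally show False
      using \<open>d \<noteq> 0\<close> \<open>v \<noteq> 0\<close> by (simp add: divide_le_0_iff)
  qed
  then show ?thesis using \<open>u \<in> S\<close> by blast
qed

lemma orthogonal_decomposition:
  fixes S :: "'a::{real_inner, complete_space} set"
  assumes "subspace S" "closed S"
  shows "\<exists>p\<in>S. \<forall>s\<in>S. inner s (x - p) = 0"
proof -
  obtain p where "p \<in> S" "\<forall>s\<in>S. inner s x = inner s p"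
    using riesz_representation_on_closed_subspace[OF bounded_linear_inner_left assms] by blast
  then show ?thesis by (auto simp: inner_diff_right)
qed

section \<open>Boundedness from the Baire category theorem\<close>

text \<open>
  The sets where \<open>norm (f x) \<le> n\<close> exhaust the space, so by Baire's theorem one of them contains a
  ball, and a linear map that is bounded on a ball is bounded.
\<close>

lemma linear_bounded_if_closed_sublevels:
  fixes f :: "'a::banach \<Rightarrow> 'b::real_normed_vector"
  assumes "linear f" and closed: "\<And>n::nat. closed {x. norm (f x) \<le> real n}"
  shows "bounded_linear f"
proof -
  define F where "F n = {x. norm (f x) \<le> real n}" for n :: nat
  have "\<Union>(range F) = UNIV"
    by (auto simp: F_def intro: real_arch_simple)
  moreover have "interior (\<Union>(range F)) = {}" if "\<And>n. interior (F n) = {}"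
    using Met_TC.metric_Baire_category_alt[where 'a='a, of "range F"] that closed
    by (auto simp: F_def complete_UNIV)
  ultimately obtain n where "interior (F n) \<noteq> {}" by auto
  then obtain a r where "0 < r" and r: "ball a r \<subseteq> F n"
    by (auto simp: mem_interior)
  have small: "norm (f h) \<le> 2 * real n" if "norm h < r" for h
  proof -
    have "a + h \<in> F n" "a \<in> F n"
      using r that \<open>0 < r\<close> by (auto simp: dist_norm)
    moreover have "f h = f (a + h) - f a"
      by (simp add: linear_add[OF \<open>linear f\<close>])
    ultimately show ?thesis
      using norm_triangle_ineq4[of "f (a + h)" "f a"] by (simp add: F_def)
  qed
  have "norm (f x) \<le> norm x * (4 * real n / r)" for x
  proof (cases "x = 0")
    case True
    then show ?thesis by (simp add: linear_0[OF \<open>linear f\<close>])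
  next
    case False
    define c where "c = r / (2 * norm x)"
    have "0 < c" using False \<open>0 < r\<close> by (simp add: c_def)
    have "norm (f (c *\<^sub>R x)) \<le> 2 * real n"
      by (rule small) (use False \<open>0 < r\<close> in \<open>simp add: c_def\<close>)
    then have "c * norm (f x) \<le> 2 * real n"
      using \<open>0 < c\<close> by (simp add: linear_scale[OF \<open>linear f\<close>])
    then show ?thesis
      using False \<open>0 < r\<close> by (simp add: c_def field_simps)
  qed
  then show ?thesis
    using \<open>linear f\<close> by (intro bounded_linear.intro bounded_linear_axioms.intro exI allI)
qed

text \<open>
  A norm bound can be tested on any set whose closure contains the vector, because the bound on
  \<open>inner y w\<close> is a closed condition on \<open>w\<close> and may then be applied to \<open>w = y\<close>.
\<close>

lemma norm_le_by_testing_dense: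
  fixes y :: "'a::real_inner"
  assumes "y \<in> closure S" and "0 \<le> r" and test: "\<And>s. s \<in> S \<Longrightarrow> inner y s \<le> r * norm s"
  shows "norm y \<le> r"
proof -
  have "closed {w. inner y w \<le> r * norm w}"
    by (intro closed_Collect_le continuous_intros)
  then have "closure S \<subseteq> {w. inner y w \<le> r * norm w}"
    using test by (intro closure_minimal) auto
  then have "norm y * norm y \<le> r * norm y"
    using assms(1) by (auto simp flip: power2_norm_eq_inner power2_eq_square)
  then show ?thesis
    using \<open>0 \<le> r\<close> by (cases "y = 0") auto
qed

section \<open>Complex inner products and adjoints\<close>

lemma cinner_add_right: "cinner x (y + z) = cinner x y + cinner x z"
  unfolding cinner_commute[of x] cinner_add_left by simp

lemma cinner_scaleC_right: "cinner x (c *\<^sub>C y) = cnj c * cinner x y"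
  unfolding cinner_commute[of x] cinner_scaleC_left by simp

text \<open>
  The complex inner product is determined by the real one, so that adjoints can be constructed
  from the real Riesz representation theorem.
\<close>

lemma cinner_eq_inner: "cinner x y = Complex (inner x y) (inner x (\<i> *\<^sub>C y))"
  by (simp add: complex_eq_iff inner_eq_Re_cinner cinner_scaleC_right)

lemma cinner_left_cancel_iff: "(\<forall>y. cinner x y = cinner x' y) \<longleftrightarrow> x = x'"
  by (metis inner_eq_Re_cinner vector_eq_rdot)

lemma norm_scaleC: "norm (c *\<^sub>C x) = cmod c * norm x"
proof -
  have "cinner (c *\<^sub>C x) (c *\<^sub>C x) = complex_of_real ((cmod c)\<^sup>2) * cinner x x"
    unfolding complex_norm_square by (simp add: cinner_scaleC_left cinner_scaleC_right)
  then have "(norm (c *\<^sub>C x))\<^sup>2 = (cmod c * norm x)\<^sup>2"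
    unfolding power2_norm_eq_inner power_mult_distrib inner_eq_Re_cinner
    by (simp del: of_real_power)
  then show ?thesis
    by (simp add: power2_eq_iff_nonneg)
qed

lemma bounded_linear_scaleC: "bounded_linear (\<lambda>x. c *\<^sub>C x)"
proof (rule bounded_linear_intro)
  show "c *\<^sub>C (x + y) = c *\<^sub>C x + c *\<^sub>C y" for x y :: 'a
    by (rule scaleC_add_right)
  show "c *\<^sub>C (r *\<^sub>R x) = r *\<^sub>R (c *\<^sub>C x)" for r and x :: 'a
    by (simp add: scaleC_scaleC mult.commute flip: scaleC_of_real)
  show "norm (c *\<^sub>C x) \<le> norm x * cmod c" for x :: 'a
    by (simp add: norm_scaleC)
qed

lemma bounded_clinearD:
  assumes "bounded_clinear T"
  shows "bounded_linear T" "T (c *\<^sub>C x) = c *\<^sub>C T x" "T (x + y) = T x + T y"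
  using assms by (auto simp: bounded_clinear_def bounded_linear.linear linear_add)

lemma bounded_clinear_compose:
  "bounded_clinear S \<Longrightarrow> bounded_clinear T \<Longrightarrow> bounded_clinear (\<lambda>x. S (T x))"
  by (auto simp: bounded_clinear_def intro: bounded_linear_compose)

lemma bounded_clinear_add:
  "bounded_clinear S \<Longrightarrow> bounded_clinear T \<Longrightarrow> bounded_clinear (\<lambda>x. S x + T x)"
  by (auto simp: bounded_clinear_def scaleC_add_right intro: bounded_linear_add)

lemma bounded_clinear_scaleC:
  "bounded_clinear T \<Longrightarrow> bounded_clinear (\<lambda>x. c *\<^sub>C T x)"
  by (auto simp: bounded_clinear_def scaleC_scaleC mult.commute
      intro: bounded_linear_compose[OF bounded_linear_scaleC])

lemma cadjoint_exists:
  fixes T :: "'a::complex_hilbert_space \<Rightarrow> 'b::complex_hilbert_space"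
  assumes T: "bounded_clinear T"
  shows "\<exists>S. bounded_clinear S \<and> (\<forall>x y. cinner (T x) y = cinner x (S y))"
proof -
  have "\<exists>u. \<forall>x. inner (T x) y = inner x u" for y
    using riesz_representation_on_closed_subspace[of "\<lambda>x. inner (T x) y" UNIV]
      bounded_linear_compose[OF bounded_linear_inner_left bounded_clinearD(1)[OF T]]
    by auto
  then obtain S where S: "\<And>x y. inner (T x) y = inner x (S y)" by metis
  have inner_imag: "inner (T x) (\<i> *\<^sub>C y) = inner x (\<i> *\<^sub>C S y)" for x y
  proof -
    have "inner v (\<i> *\<^sub>C w) = - inner (\<i> *\<^sub>C v) w" for v w :: "'c::complex_hilbert_space"
      by (simp add: inner_eq_Re_cinner cinner_scaleC_left cinner_scaleC_right)
    then show ?thesis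
      using S bounded_clinearD(2)[OF T] by metis
  qed
  have cS: "cinner (T x) y = cinner x (S y)" for x y
    unfolding cinner_eq_inner inner_imag by (simp add: S)
  obtain K where K: "\<And>x. norm (T x) \<le> norm x * K" "0 \<le> K"
    using bounded_linear.nonneg_bounded[OF bounded_clinearD(1)[OF T]] by auto
  have eqI: "u = v" if "\<And>x. cinner x u = cinner x v" for u v :: 'a
    using that by (metis cinner_commute cinner_left_cancel_iff)
  have S_scaleC: "S (c *\<^sub>C y) = c *\<^sub>C S y" for c y
    by (rule eqI) (simp add: cinner_scaleC_right flip: cS)
  have "bounded_linear S"
  proof (rule bounded_linear_intro)
    show "S (x + y) = S x + S y" for x y
      by (rule eqI) (simp add: cinner_add_right flip: cS)
    show "S (r *\<^sub>R y) = r *\<^sub>R S y" for r y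
      using S_scaleC[of "complex_of_real r"] by (simp add: scaleC_of_real)
    show "norm (S y) \<le> norm y * K" for y
    proof (cases "S y = 0")
      case True
      then show ?thesis using K(2) by simp
    next
      case False
      have "norm (S y) * norm (S y) = inner (T (S y)) y"
        by (simp add: S flip: power2_norm_eq_inner power2_eq_square)
      also have "\<dots> \<le> norm (T (S y)) * norm y"
        by (rule norm_cauchy_schwarz)
      also have "\<dots> \<le> norm (S y) * (norm y * K)"
        using mult_right_mono[OF K(1)[of "S y"], of "norm y"] by (simp add: mult_ac)
      finally show ?thesis
        using False by simp
    qed
  qed
  then show ?thesis
    using cS S_scaleC unfolding bounded_clinear_def by blast
qed

lemma
  assumes "bounded_clinear T"
  shows bounded_clinear_cadjoint: "bounded_clinear (cadjoint T)"
    and cinner_cadjoint: "cinner (T x) y = cinner x (cadjoint T y)"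
proof -
  have "\<exists>!S. bounded_clinear S \<and> (\<forall>x y. cinner (T x) y = cinner x (S y))"
  proof (rule ex_ex1I[OF cadjoint_exists[OF assms]])
    fix S S'
    assume "bounded_clinear S \<and> (\<forall>x y. cinner (T x) y = cinner x (S y))"
      "bounded_clinear S' \<and> (\<forall>x y. cinner (T x) y = cinner x (S' y))"
    then have "cinner (S y) x = cinner (S' y) x" for x y
      by (metis cinner_commute)
    then show "S = S'"
      using cinner_left_cancel_iff by blast
  qed
  then have "bounded_clinear (cadjoint T) \<and> (\<forall>x y. cinner (T x) y = cinner x (cadjoint T y))"
    unfolding cadjoint_def by (rule theI')
  then show "bounded_clinear (cadjoint T)" "cinner (T x) y = cinner x (cadjoint T y)"
    by blast+
qed

text \<open>
  Operator equations of the form \<open>B = T\<^sup>* A\<close> become identities between inner products, which can be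
  verified without mentioning the adjoint.
\<close>

lemma cadjoint_comp_eq_iff:
  assumes "bounded_clinear T"
  shows "B = cadjoint T \<circ> A \<longleftrightarrow> (\<forall>x y. cinner (B x) y = cinner (A x) (T y))"
proof -
  have "cinner (A x) (T y) = cinner ((cadjoint T \<circ> A) x) y" for x y
    unfolding cinner_commute[of _ "T y"] cinner_commute[of _ y] cinner_cadjoint[OF assms]
    by simp
  then show ?thesis
    unfolding fun_eq_iff by (simp add: cinner_left_cancel_iff)
qed

text \<open>
  Polarization: the quadratic form being real at \<open>u + v\<close> relates the imaginary parts at \<open>(u, v)\<close> and
  \<open>(v, u)\<close>, and replacing \<open>v\<close> by \<open>\<i> v\<close> turns this into the relation between the real parts.
\<close>

lemma positive_op_symmetric:
  assumes "positive_op A"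
  shows "cinner (A x) y = cinner x (A y)"
proof -
  have lin: "bounded_clinear A" and real: "\<And>x. Im (cinner (A x) x) = 0"
    using assms by (auto simp: positive_op_def complex_is_Real_iff)
  have imag: "Im (cinner (A u) v) = - Im (cinner (A v) u)" for u v
    using real[of "u + v"] real[of u] real[of v]
    by (simp add: bounded_clinearD(3)[OF lin] cinner_add_left cinner_add_right)
  have "Re (cinner (A x) y) = Re (cinner (A y) x)"
    using imag[of x "\<i> *\<^sub>C y"]
    by (simp add: bounded_clinearD(2)[OF lin] cinner_scaleC_left cinner_scaleC_right)
  then have "cinner (A x) y = cnj (cinner (A y) x)"
    using imag[of x y] by (simp add: complex_eq_iff)
  also have "\<dots> = cinner x (A y)"
    by (rule cinner_commute[symmetric])
  finally show ?thesis .
qed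

lemma positive_op_symmetric_inner: "positive_op A \<Longrightarrow> inner (A x) y = inner x (A y)"
  by (simp add: inner_eq_Re_cinner positive_op_symmetric)

section \<open>Existence and uniqueness of the A-adjoint\<close>

context
  fixes A :: "'a::complex_hilbert_space \<Rightarrow> 'a"
  assumes A: "positive_op A"
begin

lemma A_bounded_opsD: "T \<in> A_bounded_ops A \<Longrightarrow> bounded_clinear T"
  by (simp add: A_bounded_ops_def)

lemma bounded_clinear_A: "bounded_clinear A"
  using A by (simp add: positive_op_def)

lemma linear_A: "linear A"
  using bounded_clinear_A bounded_clinearD(1) bounded_linear.linear by blast

lemma subspace_closure_range: "subspace (closure (range A))"
  using linear_A by (intro subspace_closure linear_subspace_image) auto

lemma scaleC_closure_range:
  assumes "y \<in> closure (range A)"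
  shows "c *\<^sub>C y \<in> closure (range A)"
proof -
  have "(\<lambda>x. c *\<^sub>C x) ` closure (range A) \<subseteq> closure ((\<lambda>x. c *\<^sub>C x) ` range A)"
    by (rule closure_bounded_linear_image_subset[OF bounded_linear_scaleC])
  also have "\<dots> \<subseteq> closure (range A)"
    by (intro closure_mono) (auto simp flip: bounded_clinearD(2)[OF bounded_clinear_A])
  finally show ?thesis using assms by blast
qed

text \<open>
  The kernel of the symmetric operator \<open>A\<close> is orthogonal to its range, hence meets the closure of
  the range only in 0.
\<close>

lemma inj_on_closure_range: "inj_on A (closure (range A))"
proof (rule inj_onI)
  fix x y assume xy: "x \<in> closure (range A)" "y \<in> closure (range A)" "A x = A y"
  have "norm (x - y) \<le> 0"
  proof (rule norm_le_by_testing_dense)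
    show "x - y \<in> closure (range A)"
      using xy subspace_closure_range by (simp add: subspace_diff)
    show "inner (x - y) w \<le> 0 * norm w" if "w \<in> range A" for w
      using xy(3) that
      by (auto simp: linear_diff[OF linear_A] simp flip: positive_op_symmetric_inner[OF A])
  qed simp
  then show "x = y" by simp
qed

text \<open>
  The component of \<open>x\<close> orthogonal to the range of \<open>A\<close> lies in the kernel of \<open>A\<close>. Projecting onto the
  closure of the range therefore does not change \<open>A x\<close>.
\<close>

lemma image_closure_range: "A ` closure (range A) = range A"
proof -
  have "A x \<in> A ` closure (range A)" for x
  proof -
    obtain p where p: "p \<in> closure (range A)" "\<And>s. s \<in> closure (range A) \<Longrightarrow> inner s (x - p) = 0"
      using orthogonal_decomposition[OF subspace_closure_range closed_closure] by blast
    have "inner z (A (x - p)) = 0" for z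
      using p(2)[of "A z"] closure_subset[of "range A"]
      by (auto simp flip: positive_op_symmetric_inner[OF A])
    then have "A (x - p) = 0"
      using inner_eq_zero_iff by blast
    then show ?thesis
      using p(1) by (auto simp: linear_diff[OF linear_A])
  qed
  then show ?thesis by auto
qed

text \<open>
  The vector \<open>X x\<close> is the unique solution \<open>y\<close> of \<open>A y = T\<^sup>* A x\<close> in the closure of the range of \<open>A\<close>;
  uniqueness makes \<open>X\<close> linear. Boundedness is the substantial part. On the range of \<open>A\<close> the
  functional induced by \<open>X x\<close> is \<open>inner (X x) (A z) = inner x (A (T z))\<close>, which is continuous in \<open>x\<close>
  for fixed \<open>z\<close>. Since the norm of \<open>X x\<close> can be tested on that range, each sublevel set of
  \<open>norm (X x)\<close> is an intersection of closed sets, and the Baire argument applies.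
\<close>

lemma A_adjoint_exists:
  assumes T: "T \<in> A_bounded_ops A"
  shows "\<exists>X. bounded_clinear X \<and> A \<circ> X = cadjoint T \<circ> A \<and> range X \<subseteq> closure (range A)"
proof -
  have T_lin: "bounded_clinear T" and T_range: "range (cadjoint T \<circ> A) \<subseteq> range A"
    using T by (auto simp: A_bounded_ops_def)
  have "\<exists>y\<in>closure (range A). A y = cadjoint T (A x)" for x
  proof -
    have "cadjoint T (A x) \<in> A ` closure (range A)"
      unfolding image_closure_range using T_range by auto
    then show ?thesis by (metis imageE)
  qed
  then have "\<forall>x. \<exists>y. y \<in> closure (range A) \<and> A y = cadjoint T (A x)"
    by blast
  from choice[OF this]
  obtain X where X_range: "\<And>x. X x \<in> closure (range A)" and AX: "\<And>x. A (X x) = cadjoint T (A x)"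
    by blast
  have X_eqI: "X x = y" if "y \<in> closure (range A)" "A y = cadjoint T (A x)" for x y
    by (rule inj_onD[OF inj_on_closure_range]) (simp_all add: that X_range AX)
  note adj = bounded_clinearD[OF bounded_clinear_cadjoint[OF T_lin]]
    and A_lin = bounded_clinearD[OF bounded_clinear_A]
  have X_scaleC: "X (c *\<^sub>C x) = c *\<^sub>C X x" for c x
    by (rule X_eqI) (simp_all add: scaleC_closure_range X_range A_lin adj AX)
  have "linear X"
  proof (rule linearI)
    show "X (x + y) = X x + X y" for x y
      by (rule X_eqI)
         (simp_all add: subspace_add[OF subspace_closure_range] X_range A_lin adj AX)
    show "X (r *\<^sub>R x) = r *\<^sub>R X x" for r x
      using X_scaleC[of "complex_of_real r"] by (simp add: scaleC_of_real)
  qed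
  have weak: "inner (X x) (A z) = inner x (A (T z))" for x z
  proof -
    have "inner (X x) (A z) = inner (A (X x)) z"
      by (rule positive_op_symmetric_inner[OF A, symmetric])
    also have "\<dots> = inner (cadjoint T (A x)) z"
      by (simp only: AX)
    also have "\<dots> = inner (A x) (T z)"
      using cadjoint_comp_eq_iff[OF T_lin, of "cadjoint T \<circ> A" A] by (simp add: inner_eq_Re_cinner)
    also have "\<dots> = inner x (A (T z))"
      by (rule positive_op_symmetric_inner[OF A])
    finally show ?thesis .
  qed
  have "closed {x. norm (X x) \<le> real n}" for n
  proof -
    have "inner x (A (T z)) \<le> real n * norm (A z)" if "norm (X x) \<le> real n" for x z
      using norm_cauchy_schwarz[of "X x" "A z"] mult_right_mono[OF that, of "norm (A z)"]
      by (simp add: weak)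
    moreover have "norm (X x) \<le> real n" if "\<And>z. inner x (A (T z)) \<le> real n * norm (A z)" for x
      by (rule norm_le_by_testing_dense[OF X_range]) (use that in \<open>auto simp: weak\<close>)
    ultimately have "{x. norm (X x) \<le> real n} = (\<Inter>z. {x. inner x (A (T z)) \<le> real n * norm (A z)})"
      by (intro set_eqI iffI) simp_all
    moreover have "closed (\<Inter>z. {x. inner x (A (T z)) \<le> real n * norm (A z)})"
      by (intro closed_INT ballI closed_Collect_le continuous_intros)
    ultimately show ?thesis by simp
  qed
  then have "bounded_linear X"
    by (rule linear_bounded_if_closed_sublevels[OF \<open>linear X\<close>])
  then have "bounded_clinear X"
    by (simp add: bounded_clinear_def X_scaleC)
  moreover have "A \<circ> X = cadjoint T \<circ> A"
    by (rule ext) (simp add: AX)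
  moreover have "range X \<subseteq> closure (range A)"
    using X_range by blast
  ultimately show ?thesis by (intro exI conjI)
qed

lemma A_adjoint_eqI:
  assumes "bounded_clinear X" "A \<circ> X = cadjoint T \<circ> A" "range X \<subseteq> closure (range A)"
  shows "A_adjoint A T = X"
  unfolding A_adjoint_def
proof (rule the_equality)
  fix Y assume Y: "bounded_clinear Y \<and> A \<circ> Y = cadjoint T \<circ> A \<and> range Y \<subseteq> closure (range A)"
  have "Y x = X x" for x
  proof (rule inj_onD[OF inj_on_closure_range])
    have "A \<circ> Y = A \<circ> X"
      using Y assms(2) by simp
    then show "A (Y x) = A (X x)"
      by (rule comp_eq_dest)
  qed (use Y assms(3) in auto)
  then show "Y = X" by blast
qed (use assms in simp)

lemma
  assumes "T \<in> A_bounded_ops A"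
  shows bounded_clinear_A_adjoint: "bounded_clinear (A_adjoint A T)"
    and A_comp_A_adjoint: "A \<circ> A_adjoint A T = cadjoint T \<circ> A"
    and range_A_adjoint: "range (A_adjoint A T) \<subseteq> closure (range A)"
proof -
  obtain X where X: "bounded_clinear X" "A \<circ> X = cadjoint T \<circ> A" "range X \<subseteq> closure (range A)"
    using A_adjoint_exists[OF assms] by blast
  then have "A_adjoint A T = X"
    by (rule A_adjoint_eqI)
  then show "bounded_clinear (A_adjoint A T)" "A \<circ> A_adjoint A T = cadjoint T \<circ> A"
    "range (A_adjoint A T) \<subseteq> closure (range A)"
    using X by simp_all
qed

section \<open>Algebra of A-bounded operators\<close>

text \<open>
  The \<open>A\<close>-adjoint is an adjoint for the semi-inner product \<open>cinner (A x) y\<close>. All identities below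
  are reduced to these two rules by testing against vectors.
\<close>

lemma cinner_A_adjoint_left:
  assumes "T \<in> A_bounded_ops A"
  shows "cinner (A (A_adjoint A T x)) y = cinner (A x) (T y)"
  using A_comp_A_adjoint[OF assms, unfolded cadjoint_comp_eq_iff[OF A_bounded_opsD[OF assms]]]
  by simp

lemma cinner_A_adjoint_right:
  assumes "T \<in> A_bounded_ops A"
  shows "cinner (A x) (A_adjoint A T y) = cinner (A (T x)) y"
  unfolding cinner_commute[of _ "A_adjoint A T y"] cinner_commute[of _ y]
    positive_op_symmetric[OF A, symmetric] cinner_A_adjoint_left[OF assms]
  by simp

text \<open>
  A map \<open>X\<close> that is adjoint to \<open>T\<close> for the semi-inner product satisfies \<open>A X = T\<^sup>* A\<close>, so it
  witnesses the range inclusion that defines the algebra. Each closure property of the algebra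
  below is proved by writing down such an adjoint.
\<close>

lemma A_bounded_opsI:
  assumes "bounded_clinear T" and "\<And>x y. cinner (A (X x)) y = cinner (A x) (T y)"
  shows "T \<in> A_bounded_ops A"
proof -
  have "A \<circ> X = cadjoint T \<circ> A"
    using assms by (simp add: cadjoint_comp_eq_iff)
  then have "range (cadjoint T \<circ> A) = range (A \<circ> X)"
    by (rule arg_cong[OF sym])
  then show ?thesis
    using assms(1) unfolding A_bounded_ops_def by auto
qed

lemma A_adjoint_eqI_cinner:
  assumes "bounded_clinear T" "bounded_clinear X" "range X \<subseteq> closure (range A)"
    and "\<And>x y. cinner (A (X x)) y = cinner (A x) (T y)"
  shows "A_adjoint A T = X"
  using assms by (intro A_adjoint_eqI) (simp_all add: cadjoint_comp_eq_iff)

lemmas cinner_bilinear =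
  cinner_add_left cinner_add_right cinner_scaleC_left cinner_scaleC_right

lemmas A_clinear = bounded_clinearD(2,3)[OF bounded_clinear_A]

lemma A_bounded_ops_A_adjoint:
  "T \<in> A_bounded_ops A \<Longrightarrow> A_adjoint A T \<in> A_bounded_ops A"
  by (rule A_bounded_opsI[where X=T]) (simp_all add: bounded_clinear_A_adjoint cinner_A_adjoint_right)

lemma A_bounded_ops_add:
  assumes "S \<in> A_bounded_ops A" "T \<in> A_bounded_ops A"
  shows "(\<lambda>x. S x + T x) \<in> A_bounded_ops A"
  by (rule A_bounded_opsI[where X="\<lambda>x. A_adjoint A S x + A_adjoint A T x"])
     (simp_all add: assms bounded_clinear_add A_bounded_opsD A_clinear cinner_bilinear
       cinner_A_adjoint_left)

lemma A_bounded_ops_scaleC: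
  assumes "T \<in> A_bounded_ops A"
  shows "(\<lambda>x. c *\<^sub>C T x) \<in> A_bounded_ops A"
  by (rule A_bounded_opsI[where X="\<lambda>x. cnj c *\<^sub>C A_adjoint A T x"])
     (simp_all add: assms bounded_clinear_scaleC A_bounded_opsD A_clinear cinner_bilinear
       cinner_A_adjoint_left)

lemma A_bounded_ops_compose:
  assumes "S \<in> A_bounded_ops A" "T \<in> A_bounded_ops A"
  shows "(\<lambda>x. S (T x)) \<in> A_bounded_ops A"
  by (rule A_bounded_opsI[where X="\<lambda>x. A_adjoint A T (A_adjoint A S x)"])
     (simp_all add: assms bounded_clinear_compose A_bounded_opsD cinner_A_adjoint_left)

lemma A_adjoint_scaleC:
  assumes T: "T \<in> A_bounded_ops A"
  shows "A_adjoint A (\<lambda>x. c *\<^sub>C T x) = (\<lambda>x. cnj c *\<^sub>C A_adjoint A T x)"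
proof (rule A_adjoint_eqI_cinner)
  show "range (\<lambda>x. cnj c *\<^sub>C A_adjoint A T x) \<subseteq> closure (range A)"
    using range_A_adjoint[OF T] scaleC_closure_range by auto
qed (simp_all add: T bounded_clinear_scaleC A_bounded_opsD bounded_clinear_A_adjoint A_clinear
    cinner_bilinear cinner_A_adjoint_left)

lemma A_adjoint_compose:
  assumes S: "S \<in> A_bounded_ops A" and T: "T \<in> A_bounded_ops A"
  shows "A_adjoint A (\<lambda>x. S (T x)) = (\<lambda>x. A_adjoint A T (A_adjoint A S x))"
proof (rule A_adjoint_eqI_cinner)
  show "range (\<lambda>x. A_adjoint A T (A_adjoint A S x)) \<subseteq> closure (range A)"
    using range_A_adjoint[OF T] by auto
qed (simp_all add: S T bounded_clinear_compose A_bounded_opsD bounded_clinear_A_adjoint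
    cinner_A_adjoint_left)

lemma A_bounded_ops_A_real_part:
  "T \<in> A_bounded_ops A \<Longrightarrow> A_real_part A T \<in> A_bounded_ops A"
  unfolding A_real_part_def
  by (intro A_bounded_ops_scaleC A_bounded_ops_add A_bounded_ops_A_adjoint)

lemma A_selfadjoint_A_real_part:
  assumes T: "T \<in> A_bounded_ops A"
  shows "A_selfadjoint A (A_real_part A T)"
proof -
  have "cinner (A (A_real_part A T x)) y = cinner (A x) (A_real_part A T y)" for x y
    unfolding A_real_part_def
    by (simp add: T A_clinear cinner_bilinear cinner_A_adjoint_left cinner_A_adjoint_right)
  then show ?thesis
    unfolding A_selfadjoint_def
    using A_bounded_opsD[OF A_bounded_ops_A_real_part[OF T]] by (simp add: cadjoint_comp_eq_iff)
qed

lemma A_real_part_rotated: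
  assumes "T \<in> A_bounded_ops A"
  shows "A_real_part A (\<lambda>x. cis \<theta> *\<^sub>C T x) x =
    (1 / 2) *\<^sub>C (cis \<theta> *\<^sub>C T x + cis (- \<theta>) *\<^sub>C A_adjoint A T x)"
  by (simp add: A_real_part_def A_adjoint_scaleC[OF assms] cis_cnj)

section \<open>Squares of rotated real parts and the numerical radius\<close>

text \<open>
  With \<open>R = (e T + e\<^sup>* T\<^sup>#) / 2\<close> for a unit scalar \<open>e\<close> with conjugate \<open>e\<^sup>*\<close>, the mixed terms of the
  square carry the scalar 1, while the pure ones combine to twice the real part of \<open>e\<^sup>2 T\<^sup>2\<close>, because
  \<open>(T\<^sup>2)\<^sup># = (T\<^sup>#)\<^sup>2\<close>.
\<close>

lemma A_real_part_rotated_squared: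
  assumes T: "T \<in> A_bounded_ops A"
  shows "A_real_part A (\<lambda>x. cis \<theta> *\<^sub>C T x) ^^ 2 =
    (\<lambda>x. (1 / 2) *\<^sub>C A_real_part A (\<lambda>x. cis (2 * \<theta>) *\<^sub>C (T ^^ 2) x) x +
         (1 / 4) *\<^sub>C (A_adjoint A T (T x) + T (A_adjoint A T x)))"
proof (rule ext)
  fix x
  have T2: "T ^^ 2 = (\<lambda>x. T (T x))"
    by (simp add: numeral_2_eq_2 fun_eq_iff)
  note lin = bounded_clinearD(2,3)[OF A_bounded_opsD[OF T]]
    bounded_clinearD(2,3)[OF bounded_clinear_A_adjoint[OF T]]
  have cis: "cis \<theta> * cis \<theta> = cis (2 * \<theta>)" "cis (- \<theta>) * cis (- \<theta>) = cis (- (2 * \<theta>))"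
    "cis \<theta> * cis (- \<theta>) = 1" "cis (- \<theta>) * cis \<theta> = 1"
    by (simp_all add: cis_mult)
  show "(A_real_part A (\<lambda>x. cis \<theta> *\<^sub>C T x) ^^ 2) x =
    (1 / 2) *\<^sub>C A_real_part A (\<lambda>x. cis (2 * \<theta>) *\<^sub>C (T ^^ 2) x) x +
    (1 / 4) *\<^sub>C (A_adjoint A T (T x) + T (A_adjoint A T x))"
    unfolding T2 A_real_part_rotated[OF A_bounded_ops_compose[OF T T]] A_adjoint_compose[OF T T]
    by (simp add: numeral_2_eq_2 A_real_part_rotated[OF T] lin scaleC_add_right scaleC_scaleC
        cis mult.assoc)
qed

text \<open>
  The supremum defining the numerical radius bounds its members only because the set is bounded
  above; the bound \<open>(N T + N (A_adjoint A T)) / 2\<close> comes from the triangle inequality.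
\<close>

lemma A_numerical_radius_upper:
  assumes N: "A_seminorm A N" and T: "T \<in> A_bounded_ops A"
  shows "N (A_real_part A (\<lambda>x. cis \<theta> *\<^sub>C T x)) \<le> A_numerical_radius A N T"
proof -
  have N_scale: "N (\<lambda>x. c *\<^sub>C S x) = cmod c * N S"
    and N_add: "R \<in> A_bounded_ops A \<Longrightarrow> N (\<lambda>x. S x + R x) \<le> N S + N R"
    if "S \<in> A_bounded_ops A" for c S R
    using N that by (auto simp: A_seminorm_def)
  have "N (A_real_part A (\<lambda>x. cis \<phi> *\<^sub>C T x)) \<le> (N T + N (A_adjoint A T)) / 2" for \<phi>
    using N_add[OF A_bounded_ops_scaleC[OF T, of "cis \<phi>"]
        A_bounded_ops_scaleC[OF A_bounded_ops_A_adjoint[OF T], of "cis (- \<phi>)"]]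
    unfolding A_real_part_rotated[OF T]
    by (simp add: T N_scale A_bounded_ops_scaleC A_bounded_ops_add A_bounded_ops_A_adjoint)
  then have "bdd_above (range (\<lambda>\<phi>. N (A_real_part A (\<lambda>x. cis \<phi> *\<^sub>C T x))))"
    by (rule bdd_aboveI2)
  then show ?thesis
    unfolding A_numerical_radius_def by (intro cSUP_upper) auto
qed

end

theorem theorem2p14:
  fixes A T :: "'a::complex_hilbert_space \<Rightarrow> 'a"
    and N :: "('a \<Rightarrow> 'a) \<Rightarrow> real"
  assumes "positive_op A" and "A \<noteq> (\<lambda>x. 0)"
    and "A_seminorm A N" and "A_power_property A N"
    and "T \<in> A_bounded_ops A"
  shows "A_numerical_radius A N T \<le>
    sqrt (1 / 2 * A_numerical_radius A N (T ^^ 2)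
        + 1 / 4 * N (\<lambda>x. A_adjoint A T (T x) + T (A_adjoint A T x)))"
proof -
  note A = assms(1) and N = assms(3) and T = assms(5)
  have N_add: "N (\<lambda>x. S x + R x) \<le> N S + N R"
    if "S \<in> A_bounded_ops A" "R \<in> A_bounded_ops A" for S R
    using N that by (simp add: A_seminorm_def)
  have N_scaleC: "N (\<lambda>x. c *\<^sub>C S x) = cmod c * N S" if "S \<in> A_bounded_ops A" for c S
    using N that by (simp add: A_seminorm_def)
  have T2: "T ^^ 2 \<in> A_bounded_ops A"
    using A_bounded_ops_compose[OF A T T] by (simp add: numeral_2_eq_2 comp_def)
  let ?M = "\<lambda>x. A_adjoint A T (T x) + T (A_adjoint A T x)"
  have M: "?M \<in> A_bounded_ops A"
    by (rule A_bounded_ops_add[OF A A_bounded_ops_compose[OF A A_bounded_ops_A_adjoint[OF A T] T]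
          A_bounded_ops_compose[OF A T A_bounded_ops_A_adjoint[OF A T]]])
  have "N (A_real_part A (\<lambda>x. cis \<theta> *\<^sub>C T x)) \<le>
    sqrt (1 / 2 * A_numerical_radius A N (T ^^ 2) + 1 / 4 * N ?M)" for \<theta>
  proof (rule real_le_rsqrt)
    let ?R = "A_real_part A (\<lambda>x. cis \<theta> *\<^sub>C T x)"
    let ?R2 = "A_real_part A (\<lambda>x. cis (2 * \<theta>) *\<^sub>C (T ^^ 2) x)"
    have rotated: "(\<lambda>x. cis \<theta> *\<^sub>C T x) \<in> A_bounded_ops A"
      by (rule A_bounded_ops_scaleC[OF A T])
    have R2: "?R2 \<in> A_bounded_ops A"
      by (rule A_bounded_ops_A_real_part[OF A A_bounded_ops_scaleC[OF A T2]])
    have "(N ?R)\<^sup>2 = N (?R ^^ 2)"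
      using assms(4) A_bounded_ops_A_real_part[OF A rotated] A_selfadjoint_A_real_part[OF A rotated]
      unfolding A_power_property_def by (metis one_le_numeral)
    also have "\<dots> \<le> N (\<lambda>x. (1 / 2) *\<^sub>C ?R2 x) + N (\<lambda>x. (1 / 4) *\<^sub>C ?M x)"
      unfolding A_real_part_rotated_squared[OF A T]
      by (rule N_add[OF A_bounded_ops_scaleC[OF A R2] A_bounded_ops_scaleC[OF A M]])
    also have "\<dots> = 1 / 2 * N ?R2 + 1 / 4 * N ?M"
      unfolding N_scaleC[OF R2] N_scaleC[OF M] by simp
    also have "\<dots> \<le> 1 / 2 * A_numerical_radius A N (T ^^ 2) + 1 / 4 * N ?M"
      using A_numerical_radius_upper[OF A N T2, of "2 * \<theta>"] by simp
    finally show "(N ?R)\<^sup>2 \<le> 1 / 2 * A_numerical_radius A N (T ^^ 2) + 1 / 4 * N ?M" .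
  qed
  then show ?thesis
    unfolding A_numerical_radius_def[of A N T] by (intro cSUP_least) auto
qed

end
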